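(* Let $\alpha\in(0,1]$, $\gamma\in(0,\gamma_0)$ (where $\gamma_0\simeq 1.2461\ldots$) and $\delta\in[0,1)$ be given. If $f\in\mathcal{F}[A,B]$, then $f$ is starlike of order $\delta$ in the disc $|z|<r(\delta)$, where (i) for $A=-B=\alpha$, $$r(\delta)=\frac{\exp(2\alpha(1-\delta))-1}{\alpha\left(\exp(2\alpha(1-\delta))+1\right)};$$ (ii) for $A=\alpha e^{i\gamma}$ and $B=\alpha e^{-i\gamma}$, $r(\delta)$ is the smallest positive root $r$ of $$\tan(2\alpha\sin\gamma\,(\delta-1))=\frac{\alpha^4r^4\sin 2\gamma+2\alpha^3r^3\sin\gamma\cos 2\gamma-\alpha^2r^2\sin 2\gamma-2\alpha r\sin\gamma}{\alpha^4r^4\cos 2\gamma-2\alpha^3r^3\sin\gamma\sin 2\gamma-\alpha^2r^2\cos 2\gamma-\alpha^2r^2+1}.$$ The result is sharp, i.e. in each case $r(\delta)$ cannot be replaced by a larger number valid for all $f\in\mathcal{F}[A,B]$.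
   Context: $\mathbb{D}=\{z\in\mathbb{C}:|z|<1\}$; $\mathcal{A}$ is the class of analytic functions $f$ on $\mathbb{D}$ with $f(z)=z+a_2z^2+a_3z^3+\cdots$. For analytic $f,g$ on $\mathbb{D}$, $f\prec g$ ($f$ is subordinate to $g$) means $f=g\circ\omega$ for some Schwarz function $\omega$ (analytic on $\mathbb{D}$, $\omega(0)=0$, $|\omega|<1$). For $0<\alpha\le1$, and either $A=-B=\alpha$, or $A=\alpha e^{i\gamma}$, $B=\alpha e^{-i\gamma}$ with $0<\gamma\le\pi/2$, define $$\psi_{A,B}(z)=\frac{1}{A-B}\log\left(\frac{1+Az}{1+Bz}\right),\quad z\in\mathbb{D},$$ with the branch of the logarithm vanishing at $z=0$, and $$\mathcal{F}[A,B]=\left\{f\in\mathcal{A}:\ \frac{zf'(z)}{f(z)}-1\prec\psi_{A,B}(z)\right\}.$$ $f$ is starlike of order $\delta$ in the disc $|z|<\rho$ if $\operatorname{Re}(zf'(z)/f(z))>\delta$ for $|z|<\rho$. $\gamma_0\simeq1.2461\ldots$ is the zero in $(0,\pi/2)$ of $\gamma\mapsto 1+\dfrac{\gamma-\pi}{2\sin\gamma}$. When $2\alpha\sin\gamma\,(1-\delta)=\pi/2$, so that the tangent on the left of the equation in (ii) is undefined, the equation is read as saying that the denominator on the right vanishes. *)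

theory Defs
  imports "HOL-Complex_Analysis.Complex_Analysis"
begin

abbreviation unit_disc :: "complex set" where
  "unit_disc \<equiv> ball 0 1"

definition class_A :: "(complex \<Rightarrow> complex) set" where
  "class_A = {f. f holomorphic_on unit_disc \<and> f 0 = 0 \<and> deriv f 0 = 1}"

definition schwarz_function :: "(complex \<Rightarrow> complex) \<Rightarrow> bool" where
  "schwarz_function \<omega> \<longleftrightarrow>
     \<omega> holomorphic_on unit_disc \<and> \<omega> 0 = 0 \<and> (\<forall>z\<in>unit_disc. norm (\<omega> z) < 1)"

definition subordinate :: "(complex \<Rightarrow> complex) \<Rightarrow> (complex \<Rightarrow> complex) \<Rightarrow> bool" where
  "subordinate f g \<longleftrightarrow>
     f holomorphic_on unit_disc \<and> g holomorphic_on unit_disc \<and>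
     (\<exists>\<omega>. schwarz_function \<omega> \<and> (\<forall>z\<in>unit_disc. f z = g (\<omega> z)))"

text \<open>The function \<open>z f'(z) / f(z)\<close>, with its removable singularity at \<open>0\<close> filled in
  (for \<open>f\<close> in \<^const>\<open>class_A\<close> the value there is \<open>1\<close>).  At a zero of \<open>f\<close> other than \<open>0\<close> the
  quotient has a pole, so the formal value \<open>0\<close> it receives there cannot make the function
  holomorphic.\<close>

definition starlike_quotient :: "(complex \<Rightarrow> complex) \<Rightarrow> complex \<Rightarrow> complex" where
  "starlike_quotient f z = (if z = 0 then 1 else z * deriv f z / f z)"

text \<open>For the parameters considered below, the image of the unit disc under
  \<open>z \<mapsto> (1 + A z) / (1 + B z)\<close> lies in an open half-plane that contains \<open>1\<close> and has \<open>0\<close> in its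
  complement, hence avoids the nonpositive reals; so the principal logarithm is the branch
  that vanishes at \<open>z = 0\<close>.\<close>

definition psi :: "complex \<Rightarrow> complex \<Rightarrow> complex \<Rightarrow> complex" where
  "psi A B z = 1 / (A - B) * Ln ((1 + A * z) / (1 + B * z))"

definition class_F :: "complex \<Rightarrow> complex \<Rightarrow> (complex \<Rightarrow> complex) set" where
  "class_F A B = {f \<in> class_A. subordinate (\<lambda>z. starlike_quotient f z - 1) (psi A B)}"

text \<open>The requirement \<open>\<rho> \<le> 1\<close> says that the disc lies in the domain of \<open>f\<close>.\<close>

definition starlike_of_order_in_disc :: "real \<Rightarrow> (complex \<Rightarrow> complex) \<Rightarrow> real \<Rightarrow> bool" where
  "starlike_of_order_in_disc \<delta> f \<rho> \<longleftrightarrow>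
     \<rho> \<le> 1 \<and> (\<forall>z. norm z < \<rho> \<longrightarrow> Re (starlike_quotient f z) > \<delta>)"

definition sharp_starlike_radius ::
  "real \<Rightarrow> (complex \<Rightarrow> complex) set \<Rightarrow> real \<Rightarrow> bool" where
  "sharp_starlike_radius \<delta> F r \<longleftrightarrow>
     (\<forall>f\<in>F. starlike_of_order_in_disc \<delta> f r) \<and>
     (\<forall>\<rho>>r. \<exists>f\<in>F. \<not> starlike_of_order_in_disc \<delta> f \<rho>)"

definition gamma0 :: real where
  "gamma0 = (THE \<gamma>. 0 < \<gamma> \<and> \<gamma> < pi / 2 \<and> 1 + (\<gamma> - pi) / (2 * sin \<gamma>) = 0)"

lemma gamma0_ex1:
  "\<exists>!\<gamma>::real. 0 < \<gamma> \<and> \<gamma> < pi / 2 \<and> 1 + (\<gamma> - pi) / (2 * sin \<gamma>) = 0"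
proof -
  define g :: "real \<Rightarrow> real" where "g = (\<lambda>x. 2 * sin x + x - pi)"
  have eq: "1 + (x - pi) / (2 * sin x) = 0 \<longleftrightarrow> g x = 0" if "0 < x" "x < pi / 2" for x
  proof -
    have "sin x > 0" using that by (intro sin_gt_zero) auto
    then show ?thesis unfolding g_def by (auto simp: field_simps)
  qed
  have mono: "g x < g y" if "0 < x" "x < y" "y < pi / 2" for x y
    using sin_monotone_2pi[of x y] that unfolding g_def by auto
  have "\<exists>x\<ge>0. x \<le> pi / 2 \<and> g x = 0"
    using pi_less_4 pi_gt_zero unfolding g_def by (intro IVT') (auto intro!: continuous_intros)
  then obtain x where x: "0 \<le> x" "x \<le> pi / 2" "g x = 0" by blast
  have "g 0 < 0" "g (pi / 2) > 0" using pi_less_4 pi_gt_zero unfolding g_def by auto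
  then have "x \<noteq> 0" "x \<noteq> pi / 2" using x(3) by force+
  then have x': "0 < x" "x < pi / 2" using x by auto
  show ?thesis
  proof (rule ex1I[of _ x])
    show "0 < x \<and> x < pi / 2 \<and> 1 + (x - pi) / (2 * sin x) = 0" using x x' eq[of x] by blast
  next
    fix y assume y: "0 < y \<and> y < pi / 2 \<and> 1 + (y - pi) / (2 * sin y) = 0"
    then have "g y = 0" using eq[of y] by blast
    then show "y = x" using mono[of x y] mono[of y x] x x' y by (cases x y rule: linorder_cases) auto
  qed
qed

definition radius_num :: "real \<Rightarrow> real \<Rightarrow> real \<Rightarrow> real" where
  "radius_num \<alpha> \<gamma> r =
     \<alpha>^4 * r^4 * sin (2 * \<gamma>) + 2 * \<alpha>^3 * r^3 * sin \<gamma> * cos (2 * \<gamma>)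
     - \<alpha>^2 * r^2 * sin (2 * \<gamma>) - 2 * \<alpha> * r * sin \<gamma>"

definition radius_den :: "real \<Rightarrow> real \<Rightarrow> real \<Rightarrow> real" where
  "radius_den \<alpha> \<gamma> r =
     \<alpha>^4 * r^4 * cos (2 * \<gamma>) - 2 * \<alpha>^3 * r^3 * sin \<gamma> * sin (2 * \<gamma>)
     - \<alpha>^2 * r^2 * cos (2 * \<gamma>) - \<alpha>^2 * r^2 + 1"

text \<open>The equation \<open>tan (2 \<alpha> sin \<gamma> (\<delta> - 1)) = num / den\<close>.  In HOL both \<open>tan (- pi / 2)\<close> and
  \<open>x / 0\<close> equal \<open>0\<close>, so the places where one of the sides is undefined are treated explicitly:
  where the tangent is undefined, the equation means that the denominator vanishes; otherwise
  the denominator has to be nonzero.\<close>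

definition radius_equation :: "real \<Rightarrow> real \<Rightarrow> real \<Rightarrow> real \<Rightarrow> bool" where
  "radius_equation \<alpha> \<gamma> \<delta> r \<longleftrightarrow>
     (if 2 * \<alpha> * sin \<gamma> * (1 - \<delta>) = pi / 2 then radius_den \<alpha> \<gamma> r = 0
      else radius_den \<alpha> \<gamma> r \<noteq> 0 \<and>
           tan (2 * \<alpha> * sin \<gamma> * (\<delta> - 1)) = radius_num \<alpha> \<gamma> r / radius_den \<alpha> \<gamma> r)"

definition smallest_positive_root :: "(real \<Rightarrow> bool) \<Rightarrow> real \<Rightarrow> bool" where
  "smallest_positive_root P r \<longleftrightarrow> 0 < r \<and> P r \<and> (\<forall>s. 0 < s \<and> P s \<longrightarrow> r \<le> s)"

end

(* If f is in class_F A B, then z f'(z) / f(z) = 1 + psi A B (w z) with |w z| <= |z| by the Schwarz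
   lemma, so the radius is decided by the minimum of Re psi on circles, and the f belonging to w = id
   is extremal.  For A = -B the minimum on |z| = r is at -r.  In the complex case Re psi is a positive
   multiple of arg ((1 + A z) / (1 + B z)).  With x = \<alpha> r < 1, this Moebius map sends |z| <= r onto a
   disc that does not contain 0, and its smallest argument, -max_angle \<gamma> x, is the argument of the
   centre minus the half-angle that the disc subtends at 0.  Both are arctangents, and the tangent of
   their difference is the right-hand side of the radius equation.  A root with x < \<alpha> exists because
   max_angle \<gamma> x > 2 x sin \<gamma> near x = \<alpha>, which is where \<gamma> < gamma0 is needed. *)

theory Submission
  imports Defs
begin

section \<open>The starlike quotient and its extremal function\<close>

lemma linear_factor_nonzero:
  fixes A z :: complex
  assumes "norm A \<le> 1" "norm z < 1"
  shows "1 + A * z \<noteq> 0"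
proof
  assume "1 + A * z = 0"
  then have "norm (A * z) = 1"
    by (metis add_eq_0_iff norm_minus_cancel norm_one)
  moreover have "norm (A * z) \<le> norm z"
    using assms(1) by (simp add: norm_mult mult_left_le_one_le)
  ultimately show False using assms(2) by simp
qed

text \<open>A value \<open>-t\<close> with \<open>t \<ge> 0\<close> would give
  \<open>1 + t = - (A + t B) z\<close>, whose norm is at most \<open>(1 + t) * norm z\<close> and so
  less than \<open>1 + t\<close>. This makes the principal logarithm in \<open>psi\<close>
  holomorphic on the disc.\<close>

lemma moebius_not_nonpos_Reals:
  fixes A B z :: complex
  assumes "norm A \<le> 1" "norm B \<le> 1" "norm z < 1"
  shows "(1 + A * z) / (1 + B * z) \<notin> \<real>\<^sub>\<le>\<^sub>0"
proof
  assume "(1 + A * z) / (1 + B * z) \<in> \<real>\<^sub>\<le>\<^sub>0"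
  then obtain s where s: "(1 + A * z) / (1 + B * z) = of_real s" "s \<le> 0"
    by (elim nonpos_Reals_cases)
  define t where "t = - s"
  have t: "(1 + A * z) / (1 + B * z) = - of_real t" "t \<ge> 0"
    using s by (auto simp: t_def)
  have "1 + A * z = - of_real t * (1 + B * z)"
    using t(1) linear_factor_nonzero[OF assms(2,3)] by (simp add: divide_eq_eq)
  then have "of_real (1 + t) = - ((A + of_real t * B) * z)"
    by (simp, algebra)
  then have "1 + t = norm (A + of_real t * B) * norm z"
    using t(2) by (metis abs_of_nonneg add_nonneg_nonneg norm_minus_cancel norm_mult norm_of_real zero_le_one)
  also have "norm (A + of_real t * B) \<le> 1 + t"
  proof -
    have "norm (A + of_real t * B) \<le> norm A + t * norm B"
      using norm_triangle_ineq[of A "of_real t * B"] t(2) by (simp add: norm_mult)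
    also have "\<dots> \<le> 1 + t * 1"
      using assms t(2) by (intro add_mono mult_left_mono) auto
    finally show ?thesis by simp
  qed
  then have "norm (A + of_real t * B) * norm z \<le> (1 + t) * norm z"
    by (intro mult_right_mono) auto
  also have "\<dots> < 1 + t" using assms(3) t(2) by (simp add: mult_less_cancel_left2)
  finally show False by simp
qed

lemma holomorphic_on_psi:
  assumes "norm A \<le> 1" "norm B \<le> 1"
  shows "psi A B holomorphic_on unit_disc"
  unfolding psi_def
  by (intro holomorphic_intros)
     (use assms linear_factor_nonzero moebius_not_nonpos_Reals in auto)

lemma psi_0 [simp]: "psi A B 0 = 0"
  by (simp add: psi_def)

text \<open>The equation \<open>z f' / f = 1 + p\<close> is solved by
  \<open>f = z exp (G - G 0)\<close> with \<open>G' = p / z\<close>. For \<open>p = psi A B\<close>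
  this is the extremal function.\<close>

lemma class_A_prescribed_starlike_quotient:
  assumes p: "p holomorphic_on unit_disc" and p0: "p 0 = 0"
  obtains f where "f \<in> class_A" "\<And>z. z \<in> unit_disc \<Longrightarrow> starlike_quotient f z = 1 + p z"
proof -
  \<comment> \<open>Since \<open>p 0 = 0\<close>, the singularity of \<open>p z / z\<close> at 0 is
    removable, with value \<open>deriv p 0\<close>.\<close>
  define q where "q = (\<lambda>z. if z = 0 then deriv p 0 else p z / z)"
  have "q holomorphic_on unit_disc"
    by (rule pole_theorem_open_0[OF p, of 0]) (auto simp: q_def p0)
  then obtain G where G: "\<And>z. z \<in> unit_disc \<Longrightarrow> (G has_field_derivative q z) (at z within unit_disc)"
    using holomorphic_convex_primitive'[of unit_disc q] by auto
  have G': "(G has_field_derivative q z) (at z)" if "z \<in> unit_disc" for z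
    using G[OF that] that by (metis at_within_open open_ball)
  define f where "f = (\<lambda>z. z * exp (G z - G 0))"
  have f: "(f has_field_derivative (1 + z * q z) * exp (G z - G 0)) (at z)" if "z \<in> unit_disc" for z
    unfolding f_def by (rule derivative_eq_intros G' that refl)+ (simp add: algebra_simps)
  have "f holomorphic_on unit_disc"
    by (rule holomorphic_onI) (meson f field_differentiable_def field_differentiable_at_within)
  moreover have "f 0 = 0" "deriv f 0 = 1"
    using DERIV_imp_deriv[OF f[of 0]] by (auto simp: f_def)
  ultimately have "f \<in> class_A" by (simp add: class_A_def)
  moreover have "starlike_quotient f z = 1 + p z" if "z \<in> unit_disc" for z
  proof (cases "z = 0")
    case False
    then show ?thesis
      using DERIV_imp_deriv[OF f[OF that]] by (simp add: starlike_quotient_def f_def q_def)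
  qed (simp add: starlike_quotient_def p0)
  ultimately show ?thesis by (rule that)
qed

lemma starlike_quotient_class_F:
  assumes "f \<in> class_F A B" "norm z < 1"
  obtains w where "norm w \<le> norm z" "starlike_quotient f z = 1 + psi A B w"
proof -
  obtain \<omega> where \<omega>: "schwarz_function \<omega>" "\<forall>z\<in>unit_disc. starlike_quotient f z - 1 = psi A B (\<omega> z)"
    using assms(1) by (auto simp: class_F_def subordinate_def)
  have "norm (\<omega> z) \<le> norm z"
    by (rule Schwarz_Lemma(1)) (use \<omega>(1) assms(2) in \<open>auto simp: schwarz_function_def\<close>)
  moreover have "starlike_quotient f z = 1 + psi A B (\<omega> z)"
    using \<omega>(2) assms(2) by (auto simp: algebra_simps diff_eq_eq)
  ultimately show ?thesis by (rule that)
qed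

text \<open>Both parts of the theorem reduce to this criterion: the bound inside the disc passes to
  all of \<open>class_F\<close> by the Schwarz lemma, and one boundary point spoils every larger
  radius through the function with quotient \<open>1 + psi A B z\<close>.\<close>

lemma sharp_starlike_radius_class_F:
  assumes AB: "norm A \<le> 1" "norm B \<le> 1" and "r \<le> 1"
    and lower: "\<And>z. norm z < r \<Longrightarrow> Re (psi A B z) > \<delta> - 1"
    and attained: "norm z0 = r" "Re (psi A B z0) \<le> \<delta> - 1"
  shows "sharp_starlike_radius \<delta> (class_F A B) r"
proof -
  note psi_hol = holomorphic_on_psi[OF AB]
  obtain f where f: "f \<in> class_A" "\<And>z. z \<in> unit_disc \<Longrightarrow> starlike_quotient f z = 1 + psi A B z"
    using class_A_prescribed_starlike_quotient[OF psi_hol psi_0] by blast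
  have "(\<lambda>z. starlike_quotient f z - 1) holomorphic_on unit_disc"
    using psi_hol by (rule holomorphic_transform) (simp add: f)
  moreover have "schwarz_function (\<lambda>z. z)"
    by (simp add: schwarz_function_def)
  ultimately have fF: "f \<in> class_F A B"
    using f psi_hol unfolding class_F_def subordinate_def by (auto intro!: exI[of _ "\<lambda>z. z"])
  have "\<not> starlike_of_order_in_disc \<delta> f \<rho>" if "r < \<rho>" for \<rho>
  proof
    assume "starlike_of_order_in_disc \<delta> f \<rho>"
    \<comment> \<open>The condition \<rho> \<le> 1 places \<open>z0\<close> in the unit disc, as
      \<open>norm z0 = r < \<rho>\<close>; for \<open>r = 1\<close> it is itself
      contradictory.\<close>
    then have "\<rho> \<le> 1" "Re (starlike_quotient f z0) > \<delta>"
      using attained that by (auto simp: starlike_of_order_in_disc_def)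
    then show False using f(2)[of z0] attained that by auto
  qed
  moreover have "starlike_of_order_in_disc \<delta> g r" if g: "g \<in> class_F A B" for g
    unfolding starlike_of_order_in_disc_def
  proof (intro conjI allI impI)
    fix z :: complex assume z: "norm z < r"
    then obtain w where "norm w \<le> norm z" "starlike_quotient g z = 1 + psi A B w"
      using starlike_quotient_class_F[OF g, of z] \<open>r \<le> 1\<close> by auto
    then show "\<delta> < Re (starlike_quotient g z)"
      using lower[of w] z by simp
  qed fact
  ultimately show ?thesis
    using fF by (auto simp: sharp_starlike_radius_def)
qed

section \<open>The case of real parameters\<close>

text \<open>The derivative of \<open>x - tanh x\<close> is \<open>tanh x\<close> squared. The bound
  gives \<open>r \<le> 1\<close> for real parameters, where \<alpha> r is the hyperbolic tangent of
  \<alpha> (1 - \<delta>).\<close>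

lemma tanh_real_le_self:
  fixes x :: real
  assumes "0 \<le> x"
  shows "tanh x \<le> x"
proof -
  have "(\<lambda>x::real. x - tanh x) 0 \<le> (\<lambda>x. x - tanh x) x"
  proof (rule DERIV_nonneg_imp_nondecreasing[OF assms])
    fix t :: real
    have "((\<lambda>x. x - tanh x) has_real_derivative (tanh t)\<^sup>2) (at t)"
      by (auto intro!: derivative_eq_intros simp: cosh_real_nonzero)
    then show "\<exists>y. ((\<lambda>x. x - tanh x) has_real_derivative y) (at t) \<and> 0 \<le> y"
      by (intro exI conjI) auto
  qed
  then show ?thesis by simp
qed

text \<open>By the triangle inequality the ratio of \<open>norm (1 + \<alpha> z)\<close> to
  \<open>norm (1 - \<alpha> z)\<close> exceeds \<open>(1 - \<alpha> r) / (1 + \<alpha> r)\<close>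
  for \<open>norm z < r\<close>, and equals it at \<open>-r\<close>. The radius is chosen to make
  this bound \<open>1 / E\<close>.\<close>

lemma sharp_starlike_radius_real:
  fixes \<alpha> \<delta> :: real
  assumes \<alpha>: "0 < \<alpha>" "\<alpha> \<le> 1" and \<delta>: "0 \<le> \<delta>" "\<delta> < 1"
  shows "sharp_starlike_radius \<delta> (class_F (of_real \<alpha>) (- of_real \<alpha>))
           ((exp (2 * \<alpha> * (1 - \<delta>)) - 1) / (\<alpha> * (exp (2 * \<alpha> * (1 - \<delta>)) + 1)))"
proof -
  define E where "E = exp (2 * \<alpha> * (1 - \<delta>))"
  define r where "r = (E - 1) / (\<alpha> * (E + 1))"
  have E: "E > 1" using \<alpha> \<delta> by (simp add: E_def)
  have lnE: "ln E = 2 * \<alpha> * (1 - \<delta>)" by (simp add: E_def)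
  have r: "\<alpha> * r = (E - 1) / (E + 1)" "r > 0"
    using \<alpha> E by (auto simp: r_def)
  have x1: "\<alpha> * r < 1" using E r by simp
  have Er: "E * (1 - \<alpha> * r) = 1 + \<alpha> * r"
    using E by (simp add: r(1) field_simps)
  have exp_E: "exp (- 2 * (\<alpha> * (1 - \<delta>))) = inverse E"
    by (simp add: E_def algebra_simps flip: exp_minus)
  have "1 - inverse E = (E - 1) / E" "1 + inverse E = (E + 1) / E"
    using E by (simp_all add: field_simps)
  then have "(E - 1) / (E + 1) = tanh (\<alpha> * (1 - \<delta>))"
    unfolding tanh_real_altdef exp_E using E by simp
  also have "\<dots> \<le> \<alpha> * (1 - \<delta>)"
    using \<alpha> \<delta> by (intro tanh_real_le_self) auto
  also have "\<dots> \<le> \<alpha>" using \<alpha> \<delta> by (simp add: mult_le_cancel_left1)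
  finally have "\<alpha> * r \<le> \<alpha>" by (simp only: r(1))
  then have r1: "r \<le> 1" using \<alpha> by simp
  have Re_psi: "Re (psi (of_real \<alpha>) (- of_real \<alpha>) z) = (ln (norm (1 + of_real \<alpha> * z)) - ln (norm (1 - of_real \<alpha> * z))) / (2 * \<alpha>)"
    if "1 + of_real \<alpha> * z \<noteq> 0" "1 - of_real \<alpha> * z \<noteq> 0" for z
  proof -
    have "psi (of_real \<alpha>) (- of_real \<alpha>) z = of_real (1 / (2 * \<alpha>)) * Ln ((1 + of_real \<alpha> * z) / (1 - of_real \<alpha> * z))"
      by (simp add: psi_def)
    then show ?thesis
      using that by (simp add: norm_divide ln_div del: of_real_divide)
  qed
  have "sharp_starlike_radius \<delta> (class_F (of_real \<alpha>) (- of_real \<alpha>)) r"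
  proof (rule sharp_starlike_radius_class_F)
    fix z :: complex assume z: "norm z < r"
    have az: "norm (of_real \<alpha> * z) < \<alpha> * r" using z \<alpha> by (simp add: norm_mult)
    have lo: "1 - \<alpha> * r < norm (1 + of_real \<alpha> * z)"
      using az norm_diff_ineq[of 1 "of_real \<alpha> * z"] by simp
    have hi: "norm (1 - of_real \<alpha> * z) < 1 + \<alpha> * r"
      using az norm_triangle_ineq4[of 1 "of_real \<alpha> * z"] by simp
    have hi0: "0 < norm (1 - of_real \<alpha> * z)"
      using az x1 norm_triangle_ineq2[of 1 "of_real \<alpha> * z"] unfolding norm_one by linarith
    have "norm (1 - of_real \<alpha> * z) < E * norm (1 + of_real \<alpha> * z)"
      using hi lo E Er mult_strict_left_mono[OF lo, of E] by linarith
    then have "ln (norm (1 - of_real \<alpha> * z)) < ln (E * norm (1 + of_real \<alpha> * z))"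
      using hi0 by (rule ln_strict_mono)
    moreover have "ln (E * norm (1 + of_real \<alpha> * z)) = ln E + ln (norm (1 + of_real \<alpha> * z))"
      using lo x1 E by (intro ln_mult_pos) auto
    ultimately have "ln (norm (1 - of_real \<alpha> * z)) < ln E + ln (norm (1 + of_real \<alpha> * z))"
      by simp
    moreover have "1 + of_real \<alpha> * z \<noteq> 0" "1 - of_real \<alpha> * z \<noteq> 0" using lo hi0 x1 by auto
    ultimately show "Re (psi (of_real \<alpha>) (- of_real \<alpha>) z) > \<delta> - 1"
      using \<alpha> lnE by (simp add: Re_psi field_simps)
  next
    have n: "1 + complex_of_real \<alpha> * - complex_of_real r = of_real (1 - \<alpha> * r)"
            "1 - complex_of_real \<alpha> * - complex_of_real r = of_real (1 + \<alpha> * r)" by simp_all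
    have "ln (1 + \<alpha> * r) = ln E + ln (1 - \<alpha> * r)"
      using x1 E by (subst ln_mult_pos[symmetric]) (auto simp: Er)
    moreover have "0 < \<alpha> * r" using \<alpha> r(2) by simp
    ultimately show "Re (psi (of_real \<alpha>) (- of_real \<alpha>) (- of_real r)) \<le> \<delta> - 1"
      using x1 \<alpha> lnE by (subst Re_psi, unfold n norm_of_real) (auto simp: field_simps simp del: of_real_add of_real_diff of_real_mult)
  qed (use \<alpha> r r1 in auto)
  then show ?thesis by (simp add: r_def E_def)
qed

section \<open>The smallest argument on a disc\<close>

text \<open>The ray from 0 with argument -\<beta> is tangent to the circle of radius
  \<open>sin \<beta>\<close> about 1, so the disc stays on one side of it.\<close>

lemma Im_Ln_lower_bound:
  assumes u: "norm (u - 1) \<le> sin \<beta>" and \<beta>: "0 \<le> \<beta>" "\<beta> < pi / 2"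
  shows "- \<beta> \<le> Im (Ln u)" "Re u > 0"
proof -
  have s1: "sin \<beta> < 1" "0 \<le> sin \<beta>" "cos \<beta> > 0"
    using sin_monotone_2pi[of \<beta> "pi/2"] \<beta> by (auto intro: sin_ge_zero cos_gt_zero_pi)
  have "1 - Re u \<le> norm (u - 1)" using abs_Re_le_cmod[of "u - 1"] by simp
  then show Re: "Re u > 0" using u s1 by linarith
  \<comment> \<open>The real part of this product is the inner product of \<open>u - 1\<close> with
    \<open>(sin \<beta>, cos \<beta>)\<close>, the unit normal to that ray.\<close>
  have "- Re ((u - 1) * Complex (sin \<beta>) (- cos \<beta>)) \<le> norm ((u - 1) * Complex (sin \<beta>) (- cos \<beta>))"
    using abs_Re_le_cmod[of "(u - 1) * Complex (sin \<beta>) (- cos \<beta>)"] by linarith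
  also have "norm (Complex (sin \<beta>) (- cos \<beta>)) = 1" by (simp add: cmod_def)
  then have "norm ((u - 1) * Complex (sin \<beta>) (- cos \<beta>)) = norm (u - 1)" by (simp add: norm_mult)
  finally have "0 \<le> Re u * sin \<beta> + Im u * cos \<beta>" using u by (simp add: algebra_simps)
  then have "- tan \<beta> \<le> Im u / Re u" using Re s1 by (simp add: tan_def field_simps)
  then have "arctan (- tan \<beta>) \<le> arctan (Im u / Re u)" by (simp only: arctan_le_iff)
  moreover have "arctan (- tan \<beta>) = - \<beta>" using \<beta> by (simp add: arctan_minus arctan_tan)
  moreover have "Im (Ln u) = arctan (Im u / Re u)" using Re by (subst Im_Ln_eq) auto
  ultimately show "- \<beta> \<le> Im (Ln u)" by simp
qed

text \<open>The first summand is minus the argument of the centre of the image disc, the second the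
  half-angle that the disc subtends at 0.\<close>

definition max_angle :: "real \<Rightarrow> real \<Rightarrow> real" where
  "max_angle \<gamma> x =
     arctan (x\<^sup>2 * sin (2 * \<gamma>) / (1 - x\<^sup>2 * cos (2 * \<gamma>))) + arctan (2 * x * sin \<gamma> / (1 - x\<^sup>2))"

lemma complex_eq_norm_cis_arctan:
  assumes "Re z > 0"
  shows "z = of_real (norm z) * cis (arctan (Im z / Re z))"
  using assms by (metis arg_conv_arctan rcis_cmod_Arg rcis_def)

context
  fixes \<gamma> x :: real
  assumes \<gamma>: "0 < \<gamma>" "\<gamma> < pi / 2" and x: "0 < x" "x < 1"
begin

lemma sines_pos: "sin \<gamma> > 0" "cos \<gamma> > 0" "sin (2 * \<gamma>) > 0"
  using \<gamma> by (auto intro!: sin_gt_zero cos_gt_zero)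

lemma x_sq: "x\<^sup>2 > 0" "x\<^sup>2 < 1" "1 - x\<^sup>2 * cos (2 * \<gamma>) > 0"
proof -
  show 1: "x\<^sup>2 > 0" "x\<^sup>2 < 1" using x by (auto simp: power_less_one_iff)
  have "x\<^sup>2 * cos (2 * \<gamma>) \<le> x\<^sup>2 * 1" using x by (intro mult_left_mono) auto
  then show "1 - x\<^sup>2 * cos (2 * \<gamma>) > 0" using 1(2) by linarith
qed

text \<open>Here \<open>aperture\<close> is half the angle that the image disc subtends at \<open>0\<close>.\<close>

definition "image_centre = (1 - of_real (x\<^sup>2) * cis (2 * \<gamma>)) / of_real (1 - x\<^sup>2)"
definition "image_radius = 2 * x * sin \<gamma> / (1 - x\<^sup>2)"
definition "centre_angle = arctan (x\<^sup>2 * sin (2 * \<gamma>) / (1 - x\<^sup>2 * cos (2 * \<gamma>)))"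
definition "aperture = arctan image_radius"

lemma image_radius_pos: "image_radius > 0"
  unfolding image_radius_def using sines_pos x x_sq by auto

lemma angle_bounds: "0 < centre_angle" "centre_angle < pi / 2" "0 < aperture" "aperture < pi / 2"
  using sines_pos x_sq image_radius_pos arctan_ubound unfolding centre_angle_def aperture_def by auto

lemma max_angle_eq: "max_angle \<gamma> x = centre_angle + aperture"
  by (simp add: max_angle_def centre_angle_def aperture_def image_radius_def)

lemma image_centre_polar: "image_centre = of_real (norm image_centre) * cis (- centre_angle)"
proof -
  have 1: "Re image_centre > 0" "Im image_centre / Re image_centre = - (x\<^sup>2 * sin (2 * \<gamma>) / (1 - x\<^sup>2 * cos (2 * \<gamma>)))"
    using x_sq by (simp_all add: image_centre_def Re_divide_of_real Im_divide_of_real del: of_real_diff)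
  show ?thesis using complex_eq_norm_cis_arctan[OF 1(1)] unfolding 1(2) by (simp add: centre_angle_def arctan_minus)
qed

text \<open>Conjugating \<open>z\<close> turns into inversion in the unit circle under the Moebius
  map, so the image circle is orthogonal to the unit circle and its tangents from 0 have length 1.
  Hence the half-angle is the arctangent of the radius.\<close>

lemma norm_image_centre: "norm image_centre = sqrt (1 + image_radius\<^sup>2)" 
proof -
  have "(norm image_centre)\<^sup>2 = ((1 - x\<^sup>2 * cos (2 * \<gamma>))\<^sup>2 + (x\<^sup>2 * sin (2 * \<gamma>))\<^sup>2) / (1 - x\<^sup>2)\<^sup>2"
    unfolding image_centre_def norm_divide power_divide cmod_power2 by simp
  also have "(1 - x\<^sup>2 * cos (2 * \<gamma>))\<^sup>2 + (x\<^sup>2 * sin (2 * \<gamma>))\<^sup>2 = 1 - 2 * x\<^sup>2 * cos (2 * \<gamma>) + x^4 * ((sin (2 * \<gamma>))\<^sup>2 + (cos (2 * \<gamma>))\<^sup>2)"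
    by algebra
  also have "\<dots> = (1 - x\<^sup>2)\<^sup>2 + (2 * x * sin \<gamma>)\<^sup>2"
    by (simp only: sin_cos_squared_add) (simp only: cos_double_sin, algebra)
  also have "\<dots> / (1 - x\<^sup>2)\<^sup>2 = 1 + image_radius\<^sup>2"
    using x_sq by (simp add: image_radius_def power_divide add_divide_distrib)
  finally show ?thesis by (metis norm_ge_zero real_sqrt_unique)
qed

text \<open>These are the legs of the right triangle formed by 0, the centre and a point of
  tangency.\<close>

lemma norm_image_centre_mult: "norm image_centre * sin aperture = image_radius" "norm image_centre * cos aperture = 1"
  by (simp_all add: aperture_def sin_arctan cos_arctan norm_image_centre add_pos_nonneg less_imp_neq[symmetric])

lemma norm_image_centre_pos: "norm image_centre > 0"
  by (simp add: norm_image_centre add_pos_nonneg)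

lemma cis_facts: "cis \<gamma> * cis (-\<gamma>) = 1" "cis (2 * \<gamma>) = cis \<gamma> * cis \<gamma>" "cis \<gamma> - cis (-\<gamma>) = 2 * \<i> * of_real (sin \<gamma>)"
  by (auto simp: cis_mult complex_eq_iff)

text \<open>The zero \<open>- x^2 cis \<gamma>\<close> of the right-hand side is the reflection of
  the pole \<open>- cis \<gamma>\<close> in the circle of radius \<open>x\<close>; a Moebius map
  sends it to the centre of the image disc.\<close>

lemma moebius_minus_image_centre:
  assumes "1 + cis (-\<gamma>) * z \<noteq> 0"
  shows "(1 + cis \<gamma> * z) / (1 + cis (-\<gamma>) * z) - image_centre =
     2 * \<i> * of_real (sin \<gamma>) * (z + of_real (x\<^sup>2) * cis \<gamma>) / (of_real (1 - x\<^sup>2) * (1 + cis (-\<gamma>) * z))"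
proof -
  have x2: "1 - complex_of_real (x\<^sup>2) \<noteq> 0" using x_sq by (metis eq_iff_diff_eq_0 less_irrefl of_real_1 of_real_eq_iff)
  have "(1 + cis \<gamma> * z) * (1 - of_real (x\<^sup>2)) - (1 - of_real (x\<^sup>2) * cis (2 * \<gamma>)) * (1 + cis (-\<gamma>) * z)
     = (cis \<gamma> - cis (-\<gamma>)) * (z + of_real (x\<^sup>2) * cis \<gamma>)"
    unfolding cis_facts(2) using cis_facts(1) by algebra
  then show ?thesis unfolding cis_facts(3) image_centre_def of_real_diff of_real_1
    using x2 assms by (simp add: diff_frac_eq mult_ac)
qed

text \<open>Divided by its centre, the image disc becomes the disc of radius
  \<open>sin aperture\<close> about 1, to which \<open>Im_Ln_lower_bound\<close> applies.\<close>

lemma Im_Ln_moebius_ge: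
  assumes z: "norm z \<le> x"
  shows "Im (Ln ((1 + cis \<gamma> * z) / (1 + cis (-\<gamma>) * z))) \<ge> - max_angle \<gamma> x"
proof -
  define w where "w = (1 + cis \<gamma> * z) / (1 + cis (-\<gamma>) * z)"
  have "norm (cis (-\<gamma>) * z) < 1" using z x by (simp add: norm_mult)
  then have nz: "1 + cis (-\<gamma>) * z \<noteq> 0"
    by (metis add_eq_0_iff norm_minus_cancel norm_one less_irrefl)
  have "(norm (z + of_real (x\<^sup>2) * cis \<gamma>))\<^sup>2 \<le> (x * norm (cis \<gamma> + z))\<^sup>2"
  proof -
    \<comment> \<open>For \<open>c^2 + s^2 = 1\<close> the difference of squares factors as
      \<open>(1 - x^2) (x^2 - a^2 - b^2)\<close>.\<close>
    have identity: "x\<^sup>2 * ((c + a)\<^sup>2 + (s + b)\<^sup>2) - ((a + x\<^sup>2 * c)\<^sup>2 + (b + x\<^sup>2 * s)\<^sup>2) =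
        (x\<^sup>2 - x^4) * (s\<^sup>2 + c\<^sup>2) + (x\<^sup>2 - 1) * (a\<^sup>2 + b\<^sup>2)" for a b c s
      by algebra
    have "(x * norm (cis \<gamma> + z))\<^sup>2 - (norm (z + of_real (x\<^sup>2) * cis \<gamma>))\<^sup>2 = 
       (x\<^sup>2 - x^4) * ((sin \<gamma>)\<^sup>2 + (cos \<gamma>)\<^sup>2) + (x\<^sup>2 - 1) * ((Re z)\<^sup>2 + (Im z)\<^sup>2)"
      unfolding power_mult_distrib cmod_power2 using identity[of "cos \<gamma>" "Re z" "sin \<gamma>" "Im z"]
      by (simp del: sin_cos_squared_add sin_cos_squared_add2 of_real_power)
    also have "\<dots> = (1 - x\<^sup>2) * (x\<^sup>2 - (norm z)\<^sup>2)"
      unfolding sin_cos_squared_add cmod_power2[of z] by algebra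
    also have "\<dots> \<ge> 0" using z x_sq by (intro mult_nonneg_nonneg) (auto intro!: power_mono)
    finally show ?thesis by simp
  qed
  then have "norm (z + of_real (x\<^sup>2) * cis \<gamma>) \<le> x * norm (cis \<gamma> + z)"
    using x by (meson norm_ge_zero power2_le_imp_le mult_nonneg_nonneg less_imp_le)
  also have "cis \<gamma> + z = cis \<gamma> * (1 + cis (-\<gamma>) * z)"
    by (simp add: algebra_simps cis_mult)
  also have "norm \<dots> = norm (1 + cis (-\<gamma>) * z)" by (simp add: norm_mult)
  finally have *: "norm (z + of_real (x\<^sup>2) * cis \<gamma>) \<le> x * norm (1 + cis (-\<gamma>) * z)" .
  have "norm (w - image_centre) = 2 * sin \<gamma> / (1 - x\<^sup>2) * (norm (z + of_real (x\<^sup>2) * cis \<gamma>) / norm (1 + cis (-\<gamma>) * z))"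
    unfolding w_def moebius_minus_image_centre[OF nz] using sines_pos x_sq
    by (simp add: norm_mult norm_divide del: of_real_diff of_real_power)
  also have "\<dots> \<le> 2 * sin \<gamma> / (1 - x\<^sup>2) * x"
    using * nz sines_pos x_sq by (intro mult_left_mono) (auto simp: divide_le_eq)
  finally have "norm (w - image_centre) \<le> norm image_centre * sin aperture"
    by (simp add: norm_image_centre_mult image_radius_def mult_ac)
  moreover have "w - image_centre = image_centre * (w / image_centre - 1)" using norm_image_centre_pos by (auto simp: field_simps)
  ultimately have "norm (w / image_centre - 1) \<le> sin aperture" using norm_image_centre_pos by (simp add: norm_mult)
  note u = Im_Ln_lower_bound[OF this less_imp_le[OF angle_bounds(3)] angle_bounds(4)]
  have Lc: "Ln image_centre = Complex (ln (norm image_centre)) (- centre_angle)"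
  proof (rule Ln_unique)
    show "exp (Complex (ln (norm image_centre)) (- centre_angle)) = image_centre"
      using norm_image_centre_pos by (subst (2) image_centre_polar) (simp add: exp_eq_polar)
  qed (use angle_bounds in auto)
  \<comment> \<open>Both factors have arguments strictly between -pi/2 and pi/2, so their principal
    logarithms add without a jump.\<close>
  have "\<bar>Im (Ln (w / image_centre))\<bar> < pi / 2" using u(2) by (rule Re_Ln_pos_lt_imp)
  then have "Ln (image_centre * (w / image_centre)) = Ln image_centre + Ln (w / image_centre)"
    using u(2) norm_image_centre_pos angle_bounds by (intro Ln_times_simple) (auto simp: Lc)
  then have "Im (Ln w) = - centre_angle + Im (Ln (w / image_centre))"
    using norm_image_centre_pos by (simp add: Lc)
  then show ?thesis using u(1) by (simp add: w_def max_angle_eq)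
qed

lemma Im_Ln_moebius_attained:
  obtains z where "norm z = x" "Im (Ln ((1 + cis \<gamma> * z) / (1 + cis (-\<gamma>) * z))) = - max_angle \<gamma> x"
proof -
  define T where "T = max_angle \<gamma> x"
  have T: "T = centre_angle + aperture" by (simp add: T_def max_angle_eq)
  \<comment> \<open>For \<open>|e| = 1\<close> the solution \<open>z\<close> of \<open>z + x\<^sup>2 A = x e (1 + B z)\<close> has \<open>|z| = x\<close> and image
    \<open>image_centre + \<i> image_radius e\<close>; the choice \<open>e = - cis (- T)\<close> gives the point where the tangent
    from \<open>0\<close> touches the image disc.\<close>
  define z where "z = - of_real x * (cis (-T) + of_real x * cis \<gamma>) / (1 + of_real x * cis (-\<gamma>) * cis (-T))"
  have "norm (of_real x * cis (-\<gamma>) * cis (-T)) < 1" using x by (simp add: norm_mult)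
  then have d: "1 + of_real x * cis (-\<gamma>) * cis (-T) \<noteq> 0"
    by (metis add_eq_0_iff norm_minus_cancel norm_one less_irrefl)
  \<comment> \<open>Numerator and denominator of \<open>z\<close> differ, apart from
    \<open>- x\<close>, by conjugation and a unimodular factor; hence
    \<open>norm z = x\<close>.\<close>
  have "cis (-T) + of_real x * cis \<gamma> = cis (-T) * cnj (1 + of_real x * cis (-\<gamma>) * cis (-T))"
    by (simp add: algebra_simps cis_cnj cis_mult)
  then have "norm (cis (-T) + of_real x * cis \<gamma>) = norm (1 + of_real x * cis (-\<gamma>) * cis (-T))"
    by (simp only: norm_mult norm_cis complex_mod_cnj mult_1)
  then have nz: "norm z = x" using d x by (simp add: z_def norm_mult norm_divide)
  then have "norm (cis (-\<gamma>) * z) < 1" using x by (simp add: norm_mult)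
  then have d': "1 + cis (-\<gamma>) * z \<noteq> 0"
    by (metis add_eq_0_iff norm_minus_cancel norm_one less_irrefl)
  have "z * (1 + of_real x * cis (-\<gamma>) * cis (-T)) = - of_real x * (cis (-T) + of_real x * cis \<gamma>)"
    using d by (simp add: z_def)
  then have "z + of_real (x\<^sup>2) * cis \<gamma> = - of_real x * cis (-T) * (1 + cis (-\<gamma>) * z)"
    by (simp add: power2_eq_square) algebra
  then have "(1 + cis \<gamma> * z) / (1 + cis (-\<gamma>) * z) - image_centre = - (\<i> * of_real image_radius * cis (-T))"
    unfolding moebius_minus_image_centre[OF d'] using d' by (simp add: image_radius_def mult_ac)
  then have "(1 + cis \<gamma> * z) / (1 + cis (-\<gamma>) * z) = image_centre - \<i> * of_real (norm image_centre * sin aperture) * cis (-T)"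
    by (simp add: norm_image_centre_mult algebra_simps)
  also have "\<dots> = of_real (norm image_centre) * (cis (- centre_angle) - \<i> * of_real (sin aperture) * cis (-T))"
    by (subst (1) image_centre_polar) (simp add: algebra_simps)
  also have "cis (- centre_angle) = cis aperture * cis (-T)" by (simp add: cis_mult T)
  \<comment> \<open>Since \<open>norm image_centre * cos aperture = 1\<close>, the point of tangency
    is \<open>cis (-T)\<close> itself.\<close>
  also have "cis aperture * cis (-T) - \<i> * of_real (sin aperture) * cis (-T) = of_real (cos aperture) * cis (-T)"
    by (simp add: complex_eq_iff algebra_simps)
  also have "of_real (norm image_centre) * \<dots> = exp (Complex 0 (-T))"
    using norm_image_centre_mult(2) by (metis (no_types) exp_eq_polar complex.sel exp_zero mult.assoc mult_1 of_real_1 of_real_mult)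
  finally have "Ln ((1 + cis \<gamma> * z) / (1 + cis (-\<gamma>) * z)) = Complex 0 (-T)"
    using angle_bounds by (intro Ln_unique) (auto simp: T)
  then show ?thesis using that[OF nz] by (simp add: T_def)
qed

end

section \<open>The radius equation\<close>

text \<open>Both arctangents have increasing arguments. Strictness yields the strict bound on the
  open disc and excludes smaller roots of the radius equation.\<close>

lemma max_angle_strict_mono:
  assumes \<gamma>: "0 < \<gamma>" "\<gamma> < pi / 2" and "0 \<le> x" "x < y" "y < 1"
  shows "max_angle \<gamma> x < max_angle \<gamma> y"
proof -
  have s: "sin \<gamma> > 0" "sin (2 * \<gamma>) > 0"
    using \<gamma> by (auto intro!: sin_gt_zero)
  have sq: "x\<^sup>2 \<le> y\<^sup>2" "y\<^sup>2 < 1"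
    using assms by (auto simp: power_less_one_iff intro: power_mono)
  have den: "1 - t\<^sup>2 * cos (2 * \<gamma>) > 0" if "t\<^sup>2 < 1" for t
  proof -
    have "t\<^sup>2 * cos (2 * \<gamma>) \<le> t\<^sup>2 * 1" by (intro mult_left_mono) auto
    then show ?thesis using that by linarith
  qed
  have "x\<^sup>2 * sin (2 * \<gamma>) * (1 - y\<^sup>2 * cos (2 * \<gamma>)) \<le> y\<^sup>2 * sin (2 * \<gamma>) * (1 - x\<^sup>2 * cos (2 * \<gamma>))"
    using mult_right_mono[OF sq(1), of "sin (2 * \<gamma>)"] s by (simp add: algebra_simps)
  then have "x\<^sup>2 * sin (2 * \<gamma>) / (1 - x\<^sup>2 * cos (2 * \<gamma>)) \<le> y\<^sup>2 * sin (2 * \<gamma>) / (1 - y\<^sup>2 * cos (2 * \<gamma>))"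
    using den[of x] den[of y] sq by (simp add: pos_divide_le_eq pos_le_divide_eq)
  moreover have "2 * x * sin \<gamma> / (1 - x\<^sup>2) < 2 * y * sin \<gamma> / (1 - y\<^sup>2)"
    using assms s sq by (intro frac_less) auto
  ultimately show ?thesis
    unfolding max_angle_def by (intro add_le_less_mono) (auto simp: arctan_le_iff arctan_less_iff)
qed

section \<open>Lower bounds for the extremal angle\<close>

text \<open>At \<open>-x\<close> the Moebius map takes the value \<open>cnj v / v\<close>, whose
  argument is twice that of \<open>cnj v\<close>. Unlike the formula for \<open>max_angle\<close>,
  this bound stays continuous at \<open>x = 1\<close>.\<close>

lemma max_angle_ge:
  assumes \<gamma>: "0 < \<gamma>" "\<gamma> < pi / 2" and x: "0 < x" "x < 1"
  shows "2 * arctan (x * sin \<gamma> / (1 - x * cos \<gamma>)) \<le> max_angle \<gamma> x"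
proof -
  define v where "v = 1 - of_real x * cis (-\<gamma>)"
  define \<eta> where "\<eta> = arctan (x * sin \<gamma> / (1 - x * cos \<gamma>))"
  have c: "0 < cos \<gamma>" "0 < sin \<gamma>" using \<gamma> by (auto intro: cos_gt_zero sin_gt_zero)
  have "x * cos \<gamma> \<le> x" using x by (simp add: mult_left_le)
  then have xc: "x * cos \<gamma> < 1" using x by linarith
  have \<eta>: "0 < \<eta>" "\<eta> < pi / 2"
    using xc c x arctan_ubound by (auto simp: \<eta>_def)
  have Re: "Re v > 0" using xc by (simp add: v_def)
  have v: "v = of_real (norm v) * cis \<eta>"
    using complex_eq_norm_cis_arctan[OF Re] by (simp add: v_def \<eta>_def)
  have nv: "norm v \<noteq> 0" using Re by auto
  have "1 + cis \<gamma> * (- of_real x) = cnj v" by (simp add: v_def cis_cnj)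
  also have "cnj v = of_real (norm v) * cis (-\<eta>)"
    by (subst v) (simp add: cis_cnj)
  finally have 1: "1 + cis \<gamma> * (- of_real x) = of_real (norm v) * cis (-\<eta>)" .
  have 2: "1 + cis (-\<gamma>) * (- of_real x) = of_real (norm v) * cis \<eta>"
    by (subst v[symmetric]) (simp add: v_def)
  have "(1 + cis \<gamma> * (- of_real x)) / (1 + cis (-\<gamma>) * (- of_real x)) = cis (- (2 * \<eta>))"
    unfolding 1 2 using nv by (simp add: cis_divide)
  also have "\<dots> = exp (Complex 0 (- (2 * \<eta>)))" by (simp add: exp_eq_polar)
  finally have "Ln ((1 + cis \<gamma> * (- of_real x)) / (1 + cis (-\<gamma>) * (- of_real x))) = Complex 0 (- (2 * \<eta>))"
    using \<eta> by (intro Ln_unique) auto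
  then show ?thesis
    using Im_Ln_moebius_ge[OF \<gamma> x, of "- of_real x"] x by (simp add: \<eta>_def)
qed

text \<open>At \<open>gamma0\<close> the second inequality is an equality; below it
  \<open>2 sin\<close> is smaller and \<open>pi - \<gamma>\<close> larger.\<close>

lemma less_gamma0D:
  assumes "0 < \<gamma>" "\<gamma> < gamma0"
  shows "\<gamma> < pi / 2" "2 * sin \<gamma> < pi - \<gamma>"
proof -
  have g: "0 < gamma0" "gamma0 < pi / 2" "1 + (gamma0 - pi) / (2 * sin gamma0) = 0"
    using theI'[OF gamma0_ex1] by (auto simp: gamma0_def)
  show "\<gamma> < pi / 2" using assms g by linarith
  have "sin gamma0 > 0" using g by (intro sin_gt_zero) auto
  then have "2 * sin gamma0 = pi - gamma0" using g(3) by (simp add: field_simps)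
  moreover have "sin \<gamma> < sin gamma0" using assms g by (intro sin_monotone_2pi) auto
  ultimately show "2 * sin \<gamma> < pi - \<gamma>" using assms by linarith
qed

text \<open>With \<open>g x = arctan (x sin \<gamma> / (1 - x cos \<gamma>)) - x sin \<gamma>\<close>, the derivative is nonnegative exactly
  for \<open>x \<le> 2 cos \<gamma>\<close>, so on \<open>(0, 1]\<close> positivity of \<open>g\<close> reduces to \<open>g 0 = 0\<close> and
  \<open>g 1 = (pi - \<gamma>) / 2 - sin \<gamma> > 0\<close>; the latter is where \<open>\<gamma> < gamma0\<close> enters.\<close>

lemma arctan_gt_linear:
  assumes \<gamma>: "0 < \<gamma>" "\<gamma> < gamma0" and x: "0 < x" "x \<le> 1"
  shows "x * sin \<gamma> < arctan (x * sin \<gamma> / (1 - x * cos \<gamma>))"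
proof -
  note g0 = less_gamma0D[OF \<gamma>]
  define g where "g = (\<lambda>x. arctan (x * sin \<gamma> / (1 - x * cos \<gamma>)) - x * sin \<gamma>)"
  have s: "sin \<gamma> > 0" "0 < cos \<gamma>" "cos \<gamma> < 1"
    using g0 \<gamma> cos_monotone_0_pi[of 0 \<gamma>] by (auto intro: sin_gt_zero cos_gt_zero)
  have xc: "1 - t * cos \<gamma> > 0" if "0 \<le> t" "t \<le> 1" for t
    using mult_right_mono[of t 1 "cos \<gamma>"] that s by linarith
  \<comment> \<open>Both sides are the squared modulus of \<open>1 - t cis \<gamma>\<close>.\<close>
  have q: "1 - 2 * t * cos \<gamma> + t\<^sup>2 = (1 - t * cos \<gamma>)\<^sup>2 + (t * sin \<gamma>)\<^sup>2" for t
    using sin_cos_squared_add[of \<gamma>] by algebra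
  have deriv: "(g has_real_derivative sin \<gamma> * t * (2 * cos \<gamma> - t) / (1 - 2 * t * cos \<gamma> + t\<^sup>2)) (at t)"
    if t: "0 \<le> t" "t \<le> 1" for t
  proof -
    note p = xc[OF t]
    have q0: "(1 - t * cos \<gamma>)\<^sup>2 + (t * sin \<gamma>)\<^sup>2 > 0" using p by (intro add_pos_nonneg) auto
    have "1 + (t * sin \<gamma> / (1 - t * cos \<gamma>))\<^sup>2 = ((1 - t * cos \<gamma>)\<^sup>2 + (t * sin \<gamma>)\<^sup>2) / (1 - t * cos \<gamma>)\<^sup>2"
      using p by (simp add: power_divide field_simps)
    then have inv: "inverse (1 + (t * sin \<gamma> / (1 - t * cos \<gamma>))\<^sup>2) = (1 - t * cos \<gamma>)\<^sup>2 / ((1 - t * cos \<gamma>)\<^sup>2 + (t * sin \<gamma>)\<^sup>2)"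
      by simp
    have "((\<lambda>x. x * sin \<gamma> / (1 - x * cos \<gamma>)) has_real_derivative sin \<gamma> / (1 - t * cos \<gamma>)\<^sup>2) (at t)"
      using p by (auto intro!: derivative_eq_intros simp: power2_eq_square algebra_simps)
    from DERIV_chain2[OF DERIV_arctan this]
    have "((\<lambda>x. arctan (x * sin \<gamma> / (1 - x * cos \<gamma>))) has_real_derivative
        sin \<gamma> / ((1 - t * cos \<gamma>)\<^sup>2 + (t * sin \<gamma>)\<^sup>2)) (at t)"
      unfolding inv using p by simp
    from DERIV_diff[OF this DERIV_cmult_right[OF DERIV_ident, of "sin \<gamma>"]]
    have "(g has_real_derivative sin \<gamma> / ((1 - t * cos \<gamma>)\<^sup>2 + (t * sin \<gamma>)\<^sup>2) - sin \<gamma>) (at t)"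
      unfolding g_def by simp
    moreover have "sin \<gamma> / ((1 - t * cos \<gamma>)\<^sup>2 + (t * sin \<gamma>)\<^sup>2) - sin \<gamma> = sin \<gamma> * t * (2 * cos \<gamma> - t) / (1 - 2 * t * cos \<gamma> + t\<^sup>2)"
      using q0 unfolding q[symmetric] by (simp add: field_simps power2_eq_square)
    ultimately show ?thesis by simp
  qed
  have qpos: "1 - 2 * t * cos \<gamma> + t\<^sup>2 > 0" if t: "0 \<le> t" "t \<le> 1" for t
    using xc[OF t] unfolding q by (intro add_pos_nonneg) auto
  have "g x > 0"
  proof (cases "x \<le> 2 * cos \<gamma>")
    case True
    have "g 0 < g x"
    \<comment> \<open>The derivative vanishes at 0, so only its sign on the open interval is
      available.\<close>
    proof (rule DERIV_pos_imp_increasing_open[OF x(1)])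
      fix t assume t: "0 < t" "t < x"
      then have "sin \<gamma> * t * (2 * cos \<gamma> - t) / (1 - 2 * t * cos \<gamma> + t\<^sup>2) > 0"
        using True x s qpos[of t] by (intro divide_pos_pos mult_pos_pos) auto
      then show "\<exists>y. (g has_real_derivative y) (at t) \<and> 0 < y"
        using deriv[of t] t x by auto
    next
      show "continuous_on {0..x} g"
        using deriv x by (intro DERIV_atLeastAtMost_imp_continuous_on) force
    qed
    then show ?thesis by (simp add: g_def)
  next
    case False
    have "g 1 \<le> g x"
    proof (rule DERIV_nonpos_imp_nonincreasing[OF x(2)])
      fix t assume t: "x \<le> t" "t \<le> 1"
      then have "sin \<gamma> * t * (2 * cos \<gamma> - t) / (1 - 2 * t * cos \<gamma> + t\<^sup>2) \<le> 0"
        using False x s qpos[of t] by (intro divide_nonpos_pos mult_nonneg_nonpos) auto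
      then show "\<exists>y. (g has_real_derivative y) (at t) \<and> y \<le> 0"
        using deriv[of t] t x by force
    qed
    \<comment> \<open>The half-angle formulas turn this quotient into the cotangent of
      \<open>\<gamma> / 2\<close>.\<close>
    moreover have "arctan (sin \<gamma> / (1 - cos \<gamma>)) = (pi - \<gamma>) / 2"
    proof (rule arctan_unique)
      have h: "sin (\<gamma> / 2) > 0" using \<gamma> g0 by (intro sin_gt_zero) auto
      have "tan ((pi - \<gamma>) / 2) = cos (\<gamma> / 2) / sin (\<gamma> / 2)"
        by (simp add: tan_def diff_divide_distrib sin_diff cos_diff)
      also have "\<dots> = sin (2 * (\<gamma> / 2)) / (1 - cos (2 * (\<gamma> / 2)))"
        unfolding sin_double cos_double_sin using h by (simp add: power2_eq_square)
      finally show "tan ((pi - \<gamma>) / 2) = sin \<gamma> / (1 - cos \<gamma>)" by simp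
    qed (use \<gamma> g0 in auto)
    ultimately show ?thesis using g0 unfolding g_def mult_1 diff_divide_distrib by linarith
  qed
  then show ?thesis by (simp add: g_def)
qed

section \<open>The radius equation as an equation between angles\<close>

text \<open>With \<i> the imaginary unit, \<open>den - \<i> num\<close> is the product of
  \<open>P + \<i> x^2 sin (2 \<gamma>)\<close> and \<open>Q + \<i> 2 x sin \<gamma>\<close>, so its
  argument is the sum of the two arctangents and \<open>R\<close> is its modulus. No division by the
  denominator occurs, so its zeros are covered.\<close>

lemma radius_num_den_polar:
  assumes \<gamma>: "0 < \<gamma>" "\<gamma> < pi / 2" and x: "0 < \<alpha> * r" "\<alpha> * r < 1"
  obtains R where "R > 0" "radius_den \<alpha> \<gamma> r = R * cos (max_angle \<gamma> (\<alpha> * r))"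
    "radius_num \<alpha> \<gamma> r = - (R * sin (max_angle \<gamma> (\<alpha> * r)))"
proof -
  define x where "x = \<alpha> * r"
  have x': "0 < x" "x < 1" using x by (auto simp: x_def)
  define P where "P = 1 - x\<^sup>2 * cos (2 * \<gamma>)"
  define Q where "Q = 1 - x\<^sup>2"
  have PQ: "P > 0" "Q > 0" using x_sq[OF \<gamma> x'] by (auto simp: P_def Q_def)
  define t1 where "t1 = arctan (x\<^sup>2 * sin (2 * \<gamma>) / P)"
  define t2 where "t2 = arctan (2 * x * sin \<gamma> / Q)"
  have c: "cos t1 > 0" "cos t2 > 0"
    unfolding t1_def t2_def by (auto intro: cos_gt_zero_pi arctan_lbound arctan_ubound)
  have s1: "x\<^sup>2 * sin (2 * \<gamma>) * cos t1 = P * sin t1"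
    using tan_arctan[of "x\<^sup>2 * sin (2 * \<gamma>) / P"] PQ c
    unfolding t1_def[symmetric] tan_def by (simp add: field_simps)
  have s2: "2 * x * sin \<gamma> * cos t2 = Q * sin t2"
    using tan_arctan[of "2 * x * sin \<gamma> / Q"] PQ c
    unfolding t2_def[symmetric] tan_def by (simp add: field_simps)
  have T: "max_angle \<gamma> (\<alpha> * r) = t1 + t2"
    by (simp add: max_angle_def t1_def t2_def P_def Q_def flip: x_def)
  have den: "radius_den \<alpha> \<gamma> r = P * Q - x\<^sup>2 * sin (2 * \<gamma>) * (2 * x * sin \<gamma>)"
    unfolding radius_den_def P_def Q_def x_def by algebra
  have num: "radius_num \<alpha> \<gamma> r = - (x\<^sup>2 * sin (2 * \<gamma>) * Q + P * (2 * x * sin \<gamma>))"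
    unfolding radius_num_def P_def Q_def x_def by algebra
  define R where "R = P * Q / (cos t1 * cos t2)"
  have PQR: "P * Q = R * (cos t1 * cos t2)" using c by (simp add: R_def)
  have "radius_den \<alpha> \<gamma> r * (cos t1 * cos t2) = R * cos (t1 + t2) * (cos t1 * cos t2)"
    unfolding den cos_add using s1 s2 PQR by algebra
  then have "radius_den \<alpha> \<gamma> r = R * cos (t1 + t2)" using c by (subst (asm) mult_right_cancel) auto
  moreover have "radius_num \<alpha> \<gamma> r * (cos t1 * cos t2) = - (R * sin (t1 + t2)) * (cos t1 * cos t2)"
    unfolding num sin_add using s1 s2 PQR by algebra
  then have "radius_num \<alpha> \<gamma> r = - (R * sin (t1 + t2))" using c by (subst (asm) mult_right_cancel) auto
  moreover have "R > 0" using PQ c by (simp add: R_def)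
  ultimately show ?thesis using that[of R] by (simp add: T)
qed

text \<open>Both angles lie in \<open>(0, pi)\<close>, where the tangent, taken as undefined at
  \<open>pi / 2\<close>, determines the angle.\<close>

lemma radius_equation_iff:
  assumes \<gamma>: "0 < \<gamma>" "\<gamma> < pi / 2" and x: "0 < \<alpha> * r" "\<alpha> * r < 1"
    and \<theta>: "\<theta> = 2 * \<alpha> * sin \<gamma> * (1 - \<delta>)" "0 < \<theta>" "\<theta> < pi"
  shows "radius_equation \<alpha> \<gamma> \<delta> r \<longleftrightarrow> max_angle \<gamma> (\<alpha> * r) = \<theta>"
proof -
  define T where "T = max_angle \<gamma> (\<alpha> * r)"
  have T: "0 < T" "T < pi"
    using angle_bounds[OF \<gamma> x] by (auto simp: T_def max_angle_eq[OF \<gamma> x])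
  obtain R where R: "R > 0" "radius_den \<alpha> \<gamma> r = R * cos T" "radius_num \<alpha> \<gamma> r = - (R * sin T)"
    using radius_num_den_polar[OF \<gamma> x] unfolding T_def by metis
  have cos0: "cos t = 0 \<longleftrightarrow> t = pi / 2" if "0 < t" "t < pi" for t :: real
    using cos_inj_pi[of t "pi / 2"] cos_pi_half that by fastforce
  show ?thesis
  proof (cases "\<theta> = pi / 2")
    case True
    then show ?thesis using R cos0[OF T] by (auto simp: radius_equation_def T_def simp flip: \<theta>(1))
  next
    case False
    then have c\<theta>: "cos \<theta> \<noteq> 0" using cos0 \<theta> by blast
    have arg: "2 * \<alpha> * sin \<gamma> * (\<delta> - 1) = - \<theta>" by (simp add: \<theta>(1) algebra_simps)
    have "radius_equation \<alpha> \<gamma> \<delta> r \<longleftrightarrow> cos T \<noteq> 0 \<and> tan \<theta> = tan T"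
      using False R unfolding radius_equation_def arg by (simp add: tan_def flip: \<theta>(1))
    also have "\<dots> \<longleftrightarrow> T = \<theta>"
    proof
      assume "cos T \<noteq> 0 \<and> tan \<theta> = tan T"
      then have "sin (T - \<theta>) = 0" using c\<theta> by (simp add: tan_def sin_diff field_simps)
      then show "T = \<theta>" using sin_eq_0_pi[of "T - \<theta>"] T \<theta> by auto
    qed (use c\<theta> in auto)
    finally show ?thesis by (simp add: T_def)
  qed
qed

text \<open>The intermediate value theorem applies between 0 and some \<open>b < \<alpha>\<close>
  with \<open>max_angle \<gamma> b > \<theta>\<close>. Such a \<open>b\<close> comes from the lower
  bound \<open>h\<close>, which exceeds \<theta> at \<alpha> and is continuous there, even for
  \<alpha> = 1.\<close>

lemma max_angle_eq_solution:
  assumes \<gamma>: "0 < \<gamma>" "\<gamma> < gamma0" and \<alpha>: "0 < \<alpha>" "\<alpha> \<le> 1"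
    and \<theta>: "0 < \<theta>" "\<theta> \<le> 2 * \<alpha> * sin \<gamma>"
  obtains x where "0 < x" "x < \<alpha>" "max_angle \<gamma> x = \<theta>"
proof -
  note g0 = less_gamma0D[OF \<gamma>]
  define h where "h = (\<lambda>x. 2 * arctan (x * sin \<gamma> / (1 - x * cos \<gamma>)))"
  have c: "0 < cos \<gamma>" "cos \<gamma> < 1"
    using g0 \<gamma> cos_monotone_0_pi[of 0 \<gamma>] by (auto intro: cos_gt_zero)
  then have "\<alpha> * cos \<gamma> < 1" using \<alpha> mult_le_less_imp_less[of \<alpha> 1 "cos \<gamma>" 1] by simp
  then have "isCont h \<alpha>" unfolding h_def by (intro continuous_intros) auto
  moreover have "h \<alpha> > \<theta>" using arctan_gt_linear[OF \<gamma> \<alpha>] \<theta> by (simp add: h_def)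
  ultimately have "eventually (\<lambda>x. h x > \<theta>) (at_left \<alpha>)"
    by (metis isCont_def filterlim_at_split order_tendstoD(1))
  moreover have "eventually (\<lambda>x. 0 < x \<and> x < \<alpha>) (at_left \<alpha>)"
    using eventually_at_left_real[OF \<alpha>(1)] by eventually_elim auto
  ultimately have "eventually (\<lambda>x. h x > \<theta> \<and> 0 < x \<and> x < \<alpha>) (at_left \<alpha>)"
    by eventually_elim auto
  then obtain b where b: "h b > \<theta>" "0 < b" "b < \<alpha>"
    using eventually_happens[of _ "at_left \<alpha>"] trivial_limit_at_left_real[of \<alpha>] by blast
  have mb: "max_angle \<gamma> b > \<theta>"
    using max_angle_ge[of \<gamma> b] b \<alpha> \<gamma> g0 by (simp add: h_def)
  have "continuous_on {0..b} (max_angle \<gamma>)"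
    unfolding max_angle_def
  proof (intro continuous_intros ballI)
    fix t assume "t \<in> {0..b}"
    then have "t\<^sup>2 < 1" using b \<alpha> by (auto simp: power_less_one_iff)
    moreover have "t\<^sup>2 * cos (2 * \<gamma>) \<le> t\<^sup>2 * 1" by (intro mult_left_mono) auto
    ultimately show "1 - t\<^sup>2 * cos (2 * \<gamma>) \<noteq> 0" "1 - t\<^sup>2 \<noteq> 0" by linarith+
  qed
  then obtain x where x: "0 \<le> x" "x \<le> b" "max_angle \<gamma> x = \<theta>"
    using IVT'[of "max_angle \<gamma>" 0 \<theta> b] mb b \<theta> by (auto simp: max_angle_def)
  moreover have "x \<noteq> 0" using x \<theta> by (auto simp: max_angle_def)
  ultimately show ?thesis using that[of x] b by auto
qed

section \<open>The complex case and the final assembly\<close>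

lemma sharp_starlike_radius_complex:
  fixes \<alpha> \<gamma> \<delta> :: real
  assumes \<alpha>: "0 < \<alpha>" "\<alpha> \<le> 1" and \<gamma>: "0 < \<gamma>" "\<gamma> < pi / 2" and x: "0 < x" "x < \<alpha>"
    and angle: "max_angle \<gamma> x = 2 * \<alpha> * sin \<gamma> * (1 - \<delta>)"
  shows "sharp_starlike_radius \<delta> (class_F (of_real \<alpha> * cis \<gamma>) (of_real \<alpha> * cis (-\<gamma>))) (x / \<alpha>)"
proof -
  define L where "L = (\<lambda>w. Im (Ln ((1 + cis \<gamma> * w) / (1 + cis (-\<gamma>) * w))))"
  have s: "sin \<gamma> > 0" using \<gamma> by (intro sin_gt_zero) auto
  have x1: "x < 1" using x \<alpha> by linarith
  have Re_psi: "Re (psi (of_real \<alpha> * cis \<gamma>) (of_real \<alpha> * cis (-\<gamma>)) z) = L (of_real \<alpha> * z) / (2 * \<alpha> * sin \<gamma>)" for z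
  proof -
    have "of_real \<alpha> * cis \<gamma> - of_real \<alpha> * cis (-\<gamma>) = \<i> * of_real (2 * \<alpha> * sin \<gamma>)"
      by (simp add: complex_eq_iff)
    moreover have "Re (1 / (\<i> * of_real c) * w) = Im w / c" for c w
      by (cases "c = 0") (simp_all add: complex_eq_iff Re_divide power2_eq_square field_simps)
    ultimately show ?thesis
      by (simp only: psi_def L_def mult.assoc mult.left_commute[of "of_real \<alpha>"])
  qed
  have less: "L w / (2 * \<alpha> * sin \<gamma>) > \<delta> - 1 \<longleftrightarrow> L w > - max_angle \<gamma> x" for w
    using \<alpha> s unfolding angle by (simp add: field_simps)
  obtain w where w: "norm w = x" "L w = - max_angle \<gamma> x"
    using Im_Ln_moebius_attained[OF \<gamma> x(1) x1] unfolding L_def by blast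
  show ?thesis
  proof (rule sharp_starlike_radius_class_F)
    fix z :: complex assume z: "norm z < x / \<alpha>"
    \<comment> \<open>A midpoint is taken because the bound on the argument needs a positive radius,
      also for \<open>z = 0\<close>, and strictness needs one below \<open>x\<close>.\<close>
    define y where "y = (norm (of_real \<alpha> * z) + x) / 2"
    have "norm (of_real \<alpha> * z) < x" using z \<alpha> by (simp add: norm_mult field_simps)
    moreover have "2 * y = norm (of_real \<alpha> * z) + x" by (simp add: y_def)
    ultimately have y: "norm (of_real \<alpha> * z) \<le> y" "0 < y" "y < x"
      using x norm_ge_zero[of "of_real \<alpha> * z"] by linarith+
    have "L (of_real \<alpha> * z) \<ge> - max_angle \<gamma> y"
      unfolding L_def by (rule Im_Ln_moebius_ge) (use \<gamma> y x1 in auto)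
    moreover have "max_angle \<gamma> y < max_angle \<gamma> x"
      using max_angle_strict_mono[OF \<gamma>] y x1 by simp
    ultimately show "\<delta> - 1 < Re (psi (of_real \<alpha> * cis \<gamma>) (of_real \<alpha> * cis (-\<gamma>)) z)"
      unfolding Re_psi less by linarith
  next
    show "norm (w / of_real \<alpha>) = x / \<alpha>" using w \<alpha> by (simp add: norm_divide)
    show "Re (psi (of_real \<alpha> * cis \<gamma>) (of_real \<alpha> * cis (-\<gamma>)) (w / of_real \<alpha>)) \<le> \<delta> - 1"
      using w(2) \<alpha> less[of w] unfolding Re_psi by auto
  qed (use \<alpha> x in \<open>auto simp: norm_mult\<close>)
qed

theorem theorem3p1:
  fixes \<alpha> \<gamma> \<delta> :: real
  assumes "0 < \<alpha>" and "\<alpha> \<le> 1"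
    and "0 < \<gamma>" and "\<gamma> < gamma0"
    and "0 \<le> \<delta>" and "\<delta> < 1"
  shows "sharp_starlike_radius \<delta> (class_F (of_real \<alpha>) (- of_real \<alpha>))
           ((exp (2 * \<alpha> * (1 - \<delta>)) - 1) / (\<alpha> * (exp (2 * \<alpha> * (1 - \<delta>)) + 1))) \<and>
         (\<exists>r. smallest_positive_root (radius_equation \<alpha> \<gamma> \<delta>) r \<and>
              sharp_starlike_radius \<delta>
                (class_F (of_real \<alpha> * exp (\<i> * of_real \<gamma>)) (of_real \<alpha> * exp (- \<i> * of_real \<gamma>))) r)"
proof (intro conjI)
  define \<theta> where "\<theta> = 2 * \<alpha> * sin \<gamma> * (1 - \<delta>)"
  have \<gamma>: "0 < \<gamma>" "\<gamma> < pi / 2" using less_gamma0D assms by auto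
  have s: "sin \<gamma> > 0" using \<gamma> by (intro sin_gt_zero) auto
  have \<theta>: "0 < \<theta>" "\<theta> \<le> 2 * \<alpha> * sin \<gamma>"
    using assms s by (auto simp: \<theta>_def mult_le_cancel_left1)
  \<comment> \<open>Then \<theta> is at most \<open>2 sin \<gamma>\<close>, which is less than
    \<open>pi - \<gamma>\<close>.\<close>
  have "\<alpha> * sin \<gamma> \<le> sin \<gamma>" using assms s by simp
  then have \<theta>_pi: "\<theta> < pi" using \<theta> less_gamma0D[OF assms(3,4)] \<gamma> by linarith
  obtain x where x: "0 < x" "x < \<alpha>" "max_angle \<gamma> x = \<theta>"
    using max_angle_eq_solution[OF assms(3,4,1,2) \<theta>] by blast
  \<comment> \<open>The range \<open>\<alpha> * r \<le> x\<close> keeps \<alpha> r below 1 and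
    suffices for minimality, as only roots below \<open>x / \<alpha>\<close> must be
    excluded.\<close>
  have root: "radius_equation \<alpha> \<gamma> \<delta> r \<longleftrightarrow> max_angle \<gamma> (\<alpha> * r) = \<theta>" if "0 < r" "\<alpha> * r \<le> x" for r
    using radius_equation_iff[OF \<gamma> _ _ \<theta>_def \<theta>(1) \<theta>_pi] that assms x by simp
  have "smallest_positive_root (radius_equation \<alpha> \<gamma> \<delta>) (x / \<alpha>)"
    unfolding smallest_positive_root_def
  proof (intro conjI allI impI)
    show "0 < x / \<alpha>" "radius_equation \<alpha> \<gamma> \<delta> (x / \<alpha>)"
      using root[of "x / \<alpha>"] x assms by auto
    fix r assume r: "0 < r \<and> radius_equation \<alpha> \<gamma> \<delta> r"
    show "x / \<alpha> \<le> r"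
    proof (rule ccontr)
      assume "\<not> x / \<alpha> \<le> r"
      then have lt: "\<alpha> * r < x" using assms by (simp add: field_simps)
      then have "max_angle \<gamma> (\<alpha> * r) < max_angle \<gamma> x"
        using max_angle_strict_mono[OF \<gamma>, of "\<alpha> * r" x] r x assms by auto
      then show False using root[of r] r lt x by simp
    qed
  qed
  moreover have "exp (\<i> * of_real \<gamma>) = cis \<gamma>" "exp (- \<i> * of_real \<gamma>) = cis (-\<gamma>)"
    by (simp_all add: cis_conv_exp)
  ultimately show "\<exists>r. smallest_positive_root (radius_equation \<alpha> \<gamma> \<delta>) r \<and>
              sharp_starlike_radius \<delta>
                (class_F (of_real \<alpha> * exp (\<i> * of_real \<gamma>)) (of_real \<alpha> * exp (- \<i> * of_real \<gamma>))) r"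
    using sharp_starlike_radius_complex[OF assms(1,2) \<gamma> x(1,2), of \<delta>] x(3) \<theta>_def by auto
qed (rule sharp_starlike_radius_real[OF assms(1,2,5,6)])

end
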